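(* Let $\mathbb{E}$ be a Euclidean subfield of $\mathbb{R}$, let $\mathbb{F}\subseteq\mathbb{C}$ be the quadratic closure of $\mathbb{E}$, and let $f\colon\mathbb{F}\to\mathbb{F}$ be an SD map with $f(\mathbb{F}\cap\mathbb{R})\subseteq\mathbb{R}$. Then $f(z)=z$ for all $z\in\mathbb{F}$, or $f(z)=\overline{z}$ for all $z\in\mathbb{F}$.
   Context: An SD map on a field $\mathbb{F}$ is a function $f\colon \mathbb{F}\to\mathbb{F}$ such that for all $x \neq y$ in $\mathbb{F}$ one has $f(x)\neq f(y)$ and $f\left(\frac{x+y}{x-y}\right) = \frac{f(x)+f(y)}{f(x)-f(y)}$. A subfield of $\mathbb{R}$ (with the induced order) is Euclidean if every nonnegative element of it has a square root in it. The quadratic closure of $\mathbb{E}$ in $\mathbb{C}$ is the smallest subfield of $\mathbb{C}$ containing $\mathbb{E}$ in which every quadratic polynomial splits. *)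

theory Defs
  imports Complex_Main "HOL-Algebra.Algebraic_Closure_Type"
begin

lemma subfield_type_algebra_iff:
  fixes K :: "'a :: field set"
  shows "subfield K ring_of_type_algebra \<longleftrightarrow>
    1 \<in> K \<and> (\<forall>x\<in>K. \<forall>y\<in>K. x + y \<in> K) \<and> (\<forall>x\<in>K. - x \<in> K) \<and>
    (\<forall>x\<in>K. \<forall>y\<in>K. x * y \<in> K) \<and> (\<forall>x\<in>K. inverse x \<in> K)"
    (is "?L \<longleftrightarrow> ?R")
proof -
  interpret R: field "ring_of_type_algebra :: 'a ring"
    by (rule field_from_type_algebra)
  have [simp]: "carrier (ring_of_type_algebra :: 'a ring) = UNIV"
    "\<And>x y :: 'a. x \<oplus>\<^bsub>ring_of_type_algebra\<^esub> y = x + y"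
    "\<And>x y :: 'a. x \<otimes>\<^bsub>ring_of_type_algebra\<^esub> y = x * y"
    "\<zero>\<^bsub>ring_of_type_algebra\<^esub> = (0 :: 'a)" "\<one>\<^bsub>ring_of_type_algebra\<^esub> = (1 :: 'a)"
    by (simp_all add: ring_of_type_algebra_def)
  have [simp]: "\<ominus>\<^bsub>ring_of_type_algebra\<^esub> x = - x" for x :: 'a
    by (rule R.minus_equality) simp_all
  have [simp]: "inv\<^bsub>ring_of_type_algebra\<^esub> x = inverse x" if "x \<noteq> 0" for x :: 'a
    by (rule R.comm_inv_char) (use that in simp_all)
  show ?thesis
  proof
    assume L: ?L
    have sr: "subring K ring_of_type_algebra"
      by (rule subfieldE(1)[OF L])
    have "inverse x \<in> K" if "x \<in> K" for x
    proof (cases "x = 0")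
      case True
      then show ?thesis using that by simp
    next
      case False
      then show ?thesis using R.subfield_m_inv(1)[OF L, of x] that by simp
    qed
    then show ?R
      using subringE(3,5,6,7)[OF sr] by auto
  next
    assume r: ?R
    have "subring K ring_of_type_algebra"
      by (rule R.subringI) (use r in simp_all)
    then show ?L
      by (rule R.subfieldI') (use r in auto)
  qed
qed

definition euclidean_subfield :: "real set \<Rightarrow> bool" where
  "euclidean_subfield E \<longleftrightarrow>
     subfield E ring_of_type_algebra \<and> (\<forall>x\<in>E. x \<ge> 0 \<longrightarrow> (\<exists>y\<in>E. y\<^sup>2 = x))"

text \<open>Polynomials over a subfield \<open>K\<close> are the polynomials over the ambient field all of whose
  coefficients lie in \<open>K\<close>.\<close>

definition quadratics_split :: "'a :: field set \<Rightarrow> bool" where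
  "quadratics_split K \<longleftrightarrow>
     (\<forall>p :: 'a poly. Polynomial.degree p = 2 \<longrightarrow> (\<forall>i. poly.coeff p i \<in> K) \<longrightarrow>
        (\<exists>r\<in>K. \<exists>s\<in>K. p = Polynomial.smult (Polynomial.lead_coeff p) ([:- r, 1:] * [:- s, 1:])))"

definition quadratic_closure :: "complex set \<Rightarrow> complex set" where
  "quadratic_closure E =
     \<Inter>{K. subfield K ring_of_type_algebra \<and> E \<subseteq> K \<and> quadratics_split K}"

text \<open>The intersection defining \<open>quadratic_closure\<close> belongs to the family it is taken over, and
  thus is the least member of that family.\<close>

lemma quadratic_closure_least:
  assumes "subfield K ring_of_type_algebra" "E \<subseteq> K" "quadratics_split K"
  shows "quadratic_closure E \<subseteq> K"
  using assms unfolding quadratic_closure_def by blast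

lemma quadratic_closure_superset: "E \<subseteq> quadratic_closure E"
  unfolding quadratic_closure_def by blast

lemma subfield_quadratic_closure: "subfield (quadratic_closure E) ring_of_type_algebra"
  unfolding quadratic_closure_def subfield_type_algebra_iff by auto

lemma smult_linear_factors_root_cases:
  fixes a r s t u :: "'a :: field"
  assumes "Polynomial.smult a ([:- r, 1:] * [:- s, 1:]) =
           Polynomial.smult a ([:- t, 1:] * [:- u, 1:])" "a \<noteq> 0"
  shows "r = t \<and> s = u \<or> r = u \<and> s = t"
proof -
  have "r * s = t * u" "a * (t + u) = a * (r + s)"
    using assms by (auto simp: algebra_simps)
  then have e: "r * s = t * u" "r + s = t + u"
    using assms(2) by simp_all
  have "(r - t) * (r - u) = r * r - r * (t + u) + t * u"
    by (simp add: algebra_simps)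
  also have "\<dots> = 0"
    unfolding e[symmetric] by (simp add: algebra_simps)
  finally have "(r - t) * (r - u) = 0" .
  then show ?thesis using e(2) by auto
qed

lemma quadratics_split_quadratic_closure: "quadratics_split (quadratic_closure E)"
  unfolding quadratics_split_def
proof (intro allI impI)
  fix p :: "complex poly"
  assume deg: "Polynomial.degree p = 2" and co: "\<forall>i. poly.coeff p i \<in> quadratic_closure E"
  let ?a = "Polynomial.lead_coeff p"
  let ?S = "{K. subfield K ring_of_type_algebra \<and> E \<subseteq> K \<and> quadratics_split K}"
  have a0: "?a \<noteq> 0" using deg by (metis leading_coeff_0_iff degree_0 zero_neq_numeral)
  have split: "\<exists>r\<in>K. \<exists>s\<in>K. p = Polynomial.smult ?a ([:- r, 1:] * [:- s, 1:])"
    if "K \<in> ?S" for K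
    using that co deg unfolding quadratics_split_def quadratic_closure_def by blast
  have "quadratics_split (UNIV :: complex set)"
    unfolding quadratics_split_def
  proof (intro allI impI)
    fix q :: "complex poly"
    assume dq: "Polynomial.degree q = 2"
    define b c d where bcd: "b = poly.coeff q 1" "c = poly.coeff q 0" "d = poly.coeff q 2"
    have "q = [:c, b, d:]"
      using coeff_eq_0[of q] dq
      by (intro poly_eqI) (simp add: bcd coeff_pCons numeral_2_eq_2 split: nat.split)
    moreover have "d \<noteq> 0"
      using dq bcd(3) by (metis leading_coeff_0_iff degree_0 zero_neq_numeral)
    ultimately have q: "q = [:c, b, d:]" "d \<noteq> 0" by blast+
    then have leadq: "Polynomial.lead_coeff q = d" by simp
    define w where "w = csqrt (b\<^sup>2 - 4 * d * c)"
    have w: "w\<^sup>2 = b\<^sup>2 - 4 * d * c" by (simp add: w_def)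
    have "q = Polynomial.smult d ([:- ((- b + w) / (2 * d)), 1:] * [:- ((- b - w) / (2 * d)), 1:])"
    proof -
      have "(b - w) * (b + w) = 4 * d * c"
        using w by (simp add: algebra_simps power2_eq_square)
      then have "d * ((- ((- b + w) / (2 * d))) * (- ((- b - w) / (2 * d)))) = c"
        using q(2) by (simp add: divide_simps) (simp add: algebra_simps)
      moreover have "d * (- ((- b + w) / (2 * d)) + - ((- b - w) / (2 * d))) = b"
        using q(2) by (simp add: field_simps)
      ultimately show ?thesis
        using q(1) by (simp add: algebra_simps)
    qed
    then show "\<exists>r\<in>UNIV. \<exists>s\<in>UNIV. q = Polynomial.smult (Polynomial.lead_coeff q) ([:- r, 1:] * [:- s, 1:])"
      using leadq by (metis UNIV_I)
  qed
  then have "UNIV \<in> ?S" by (simp add: subfield_type_algebra_iff)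
  from split[OF this] obtain r s where
    rs: "p = Polynomial.smult ?a ([:- r, 1:] * [:- s, 1:])" by blast
  have "r \<in> K \<and> s \<in> K" if K: "K \<in> ?S" for K
    using split[OF K] smult_linear_factors_root_cases[OF _ a0] rs by metis
  then have "r \<in> quadratic_closure E" "s \<in> quadratic_closure E"
    unfolding quadratic_closure_def by blast+
  with rs show "\<exists>r\<in>quadratic_closure E. \<exists>s\<in>quadratic_closure E.
      p = Polynomial.smult ?a ([:- r, 1:] * [:- s, 1:])" by blast
qed

text \<open>A map \<open>K \<rightarrow> K\<close> is represented by a total function on the ambient field; its values outside
  \<open>K\<close> play no role.\<close>

definition SD_map_on :: "'a :: field set \<Rightarrow> ('a \<Rightarrow> 'a) \<Rightarrow> bool" where
  "SD_map_on K f \<longleftrightarrow> f \<in> K \<rightarrow> K \<and>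
     (\<forall>x\<in>K. \<forall>y\<in>K. x \<noteq> y \<longrightarrow>
        f x \<noteq> f y \<and> f ((x + y) / (x - y)) = (f x + f y) / (f x - f y))"

end

theory Submission
  imports Defs
begin

text \<open>
  An SD map is multiplicative, because \<open>(c x + c y) / (c x - c y)\<close> does not depend on \<open>c\<close>.
  Computing \<open>f 5\<close> from \<open>5 = (3 + 2) / (3 - 2)\<close> and from \<open>5 / 3 = (4 + 1) / (4 - 1)\<close> forces
  \<open>f 2 = 2\<close>, hence \<open>f\<close> fixes the rationals. In a Euclidean field the positive elements are the
  nonzero squares, so \<open>f\<close> preserves positivity; the SD identity turns this into monotonicity, and
  so \<open>f\<close> is the identity on \<open>E\<close>. Finally \<open>f \<i> = \<plusminus>\<i>\<close>, and the values of \<open>f\<close> at the product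
  and the quotient of \<open>w\<close> and \<open>cnj w\<close> determine \<open>f w\<close> up to sign; since every \<open>z\<close> in \<open>F = E(\<i>)\<close> is
  a square \<open>w\<^sup>2\<close>, this determines \<open>f z = (f w)\<^sup>2\<close>.
\<close>

section \<open>Square roots and the quadratic closure\<close>

lemma subfield_type_algebra_closed:
  fixes K :: "'a :: field set"
  assumes "subfield K ring_of_type_algebra"
  shows "0 \<in> K" and "1 \<in> K" and "\<And>x y. x \<in> K \<Longrightarrow> y \<in> K \<Longrightarrow> x + y \<in> K"
    and "\<And>x. x \<in> K \<Longrightarrow> - x \<in> K" and "\<And>x y. x \<in> K \<Longrightarrow> y \<in> K \<Longrightarrow> x - y \<in> K"
    and "\<And>x y. x \<in> K \<Longrightarrow> y \<in> K \<Longrightarrow> x * y \<in> K"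
    and "\<And>x y. x \<in> K \<Longrightarrow> y \<in> K \<Longrightarrow> x / y \<in> K"
proof -
  have one: "1 \<in> K" and add: "\<And>x y. x \<in> K \<Longrightarrow> y \<in> K \<Longrightarrow> x + y \<in> K"
    and minus: "\<And>x. x \<in> K \<Longrightarrow> - x \<in> K"
    and mult: "\<And>x y. x \<in> K \<Longrightarrow> y \<in> K \<Longrightarrow> x * y \<in> K"
    and inv: "\<And>x. x \<in> K \<Longrightarrow> inverse x \<in> K"
    using assms unfolding subfield_type_algebra_iff by auto
  have diff: "\<And>x y. x \<in> K \<Longrightarrow> y \<in> K \<Longrightarrow> x - y \<in> K"
    by (metis add minus diff_conv_add_uminus)
  show "\<And>x y. x \<in> K \<Longrightarrow> y \<in> K \<Longrightarrow> x / y \<in> K"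
    by (metis mult inv divide_inverse)
  show "0 \<in> K" using diff[OF one one] by simp
  show "1 \<in> K" "\<And>x y. x \<in> K \<Longrightarrow> y \<in> K \<Longrightarrow> x + y \<in> K" "\<And>x. x \<in> K \<Longrightarrow> - x \<in> K"
    "\<And>x y. x \<in> K \<Longrightarrow> y \<in> K \<Longrightarrow> x - y \<in> K" "\<And>x y. x \<in> K \<Longrightarrow> y \<in> K \<Longrightarrow> x * y \<in> K"
    by (fact one add minus diff mult)+
qed

text \<open>The quadratic formula stays inside \<open>K\<close> once the discriminant has a root
  there; \<open>2 * d\<close> is invertible because the characteristic is 0.\<close>

lemma quadratics_split_if_sqrt_closed:
  fixes K :: "'a :: field_char_0 set"
  assumes K: "subfield K ring_of_type_algebra"
    and sqrt: "\<And>z. z \<in> K \<Longrightarrow> \<exists>w\<in>K. w\<^sup>2 = z"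
  shows "quadratics_split K"
  unfolding quadratics_split_def
proof (intro allI impI)
  fix p :: "'a poly"
  assume deg: "Polynomial.degree p = 2" and co: "\<forall>i. poly.coeff p i \<in> K"
  note one = subfield_type_algebra_closed(2)[OF K] and add = subfield_type_algebra_closed(3)[OF K]
    and minus = subfield_type_algebra_closed(4)[OF K] and diff = subfield_type_algebra_closed(5)[OF K]
    and mult = subfield_type_algebra_closed(6)[OF K] and div = subfield_type_algebra_closed(7)[OF K]
  have two: "2 \<in> K" using add[OF one one] by simp
  have four: "4 \<in> K" using add[OF two two] by simp
  define b c d where bcd: "b = poly.coeff p 1" "c = poly.coeff p 0" "d = poly.coeff p 2"
  have bcdK: "b \<in> K" "c \<in> K" "d \<in> K" using co by (simp_all add: bcd)
  have p: "p = [:c, b, d:]"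
    using coeff_eq_0[of p] deg
    by (intro poly_eqI) (simp add: bcd coeff_pCons numeral_2_eq_2 split: nat.split)
  have d: "d \<noteq> 0"
    using deg bcd(3) by (metis leading_coeff_0_iff degree_0 zero_neq_numeral)
  have "b\<^sup>2 - 4 * d * c \<in> K"
    using bcdK four by (simp add: power2_eq_square mult diff)
  then obtain w where wK: "w \<in> K" and w: "w\<^sup>2 = b\<^sup>2 - 4 * d * c"
    using sqrt by blast
  let ?r = "(- b + w) / (2 * d)" and ?s = "(- b - w) / (2 * d)"
  have "(b - w) * (b + w) = 4 * d * c"
    using w by (simp add: algebra_simps power2_eq_square)
  then have "d * ((- ?r) * (- ?s)) = c"
    using d by (simp add: divide_simps) (simp add: algebra_simps)
  moreover have "d * (- ?r + - ?s) = b"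
    using d by (simp add: field_simps)
  ultimately have "p = Polynomial.smult d ([:- ?r, 1:] * [:- ?s, 1:])"
    using p by (simp add: algebra_simps)
  moreover have "?r \<in> K" "?s \<in> K"
    using bcdK wK two by (simp_all add: add minus mult diff div del: uminus_add_conv_diff)
  moreover have "Polynomial.lead_coeff p = d" using p d by simp
  ultimately show "\<exists>r\<in>K. \<exists>s\<in>K.
      p = Polynomial.smult (Polynomial.lead_coeff p) ([:- r, 1:] * [:- s, 1:])"
    by metis
qed

text \<open>Split X^2 - z: the two roots sum to 0 and multiply to - z, so each squares to z.\<close>

lemma quadratics_split_sqrt:
  assumes K: "subfield K ring_of_type_algebra" and "quadratics_split K" "z \<in> K"
  shows "\<exists>w\<in>K. w\<^sup>2 = z"
proof -
  have "0 \<in> K" "1 \<in> K" "- z \<in> K"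
    using subfield_type_algebra_closed[OF K] \<open>z \<in> K\<close> by auto
  then have "\<forall>i. poly.coeff [:- z, 0, 1:] i \<in> K"
    by (auto simp: coeff_pCons split: nat.split)
  moreover have "Polynomial.degree [:- z, 0, 1:] = 2" by simp
  ultimately obtain r s where "r \<in> K"
    and "[:- z, 0, 1:] = Polynomial.smult (Polynomial.lead_coeff [:- z, 0, 1:]) ([:- r, 1:] * [:- s, 1:])"
    using \<open>quadratics_split K\<close> unfolding quadratics_split_def by blast
  then have "r * s = - z" "r + s = 0" by (auto simp: algebra_simps)
  then have "r\<^sup>2 = z"
    by (metis add.inverse_inverse add_eq_0_iff mult_minus_right power2_eq_square)
  with \<open>r \<in> K\<close> show ?thesis by blast
qed

lemma euclidean_subfield_sqrt:
  assumes "euclidean_subfield E" "x \<in> E" "x \<ge> 0"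
  shows "sqrt x \<in> E"
proof -
  obtain y where "y \<in> E" "y\<^sup>2 = x"
    using assms unfolding euclidean_subfield_def by blast
  \<comment> \<open>The given root \<open>y\<close> may be negative, in which case
    \<open>sqrt x = - y\<close>.\<close>
  moreover have "- y \<in> E"
    using assms(1) \<open>y \<in> E\<close> unfolding euclidean_subfield_def subfield_type_algebra_iff by blast
  ultimately show ?thesis by (metis abs_real_def real_sqrt_abs)
qed

text \<open>This identifies the closure with E(\<i>). E(\<i>) is a subfield closed under square
  roots, so minimality gives one inclusion; the other only needs \<i> in the closure, as a root of
  -1.\<close>

lemma quadratic_closure_euclidean:
  assumes E: "euclidean_subfield E"
  shows "quadratic_closure (complex_of_real ` E) = {z. Re z \<in> E \<and> Im z \<in> E}"
proof
  let ?K = "{z. Re z \<in> E \<and> Im z \<in> E}" and ?F = "quadratic_closure (complex_of_real ` E)"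
  have sE: "subfield E ring_of_type_algebra"
    using E unfolding euclidean_subfield_def by blast
  note zero = subfield_type_algebra_closed(1)[OF sE] and one = subfield_type_algebra_closed(2)[OF sE]
    and add = subfield_type_algebra_closed(3)[OF sE] and minus = subfield_type_algebra_closed(4)[OF sE]
    and diff = subfield_type_algebra_closed(5)[OF sE] and mult = subfield_type_algebra_closed(6)[OF sE]
    and div = subfield_type_algebra_closed(7)[OF sE]
  have two: "2 \<in> E" using add[OF one one] by simp
  have K: "subfield ?K ring_of_type_algebra"
    unfolding subfield_type_algebra_iff
    by (auto simp: one zero add minus mult diff div power2_eq_square)
  have "\<exists>w\<in>?K. w\<^sup>2 = z" if "z \<in> ?K" for z
  proof
    \<comment> \<open>Up to sign, the parts of \<open>csqrt z\<close> are the roots of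
      \<open>(cmod z + Re z) / 2\<close> and \<open>(cmod z - Re z) / 2\<close>, so the modulus has
      to lie in \<open>E\<close> first.\<close>
    have "sqrt ((Re z)\<^sup>2 + (Im z)\<^sup>2) \<in> E"
      using that by (intro euclidean_subfield_sqrt[OF E]) (auto simp: power2_eq_square add mult)
    then have n: "cmod z \<in> E" by (simp add: cmod_def)
    have "\<bar>Re z\<bar> \<le> cmod z" by (rule abs_Re_le_cmod)
    then have "sqrt ((cmod z + Re z) / 2) \<in> E" "sqrt ((cmod z - Re z) / 2) \<in> E"
      using that n two by (auto intro!: euclidean_subfield_sqrt[OF E] add diff div)
    then show "csqrt z \<in> ?K"
      by (auto simp: sgn_if minus)
  qed simp
  then have "quadratics_split ?K"
    by (rule quadratics_split_if_sqrt_closed[OF K])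
  then show "?F \<subseteq> ?K"
    by (intro quadratic_closure_least K) (auto simp: zero)
  show "?K \<subseteq> ?F"
  proof
    fix z assume z: "z \<in> ?K"
    note closed = subfield_type_algebra_closed[OF subfield_quadratic_closure]
    have EF: "complex_of_real x \<in> ?F" if "x \<in> E" for x
      using quadratic_closure_superset that by blast
    have "- 1 \<in> ?F" using closed(4)[OF EF[OF one]] by simp
    then obtain w where "w \<in> ?F" "w\<^sup>2 = - 1"
      using quadratics_split_sqrt[OF subfield_quadratic_closure quadratics_split_quadratic_closure]
      by blast
    then have "w = \<i> \<or> w = - \<i>" by (metis power2_eq_iff power2_i)
    then have "\<i> \<in> ?F" using closed(4)[OF \<open>w \<in> ?F\<close>] \<open>w \<in> ?F\<close> by auto
    then have "of_real (Re z) + \<i> * of_real (Im z) \<in> ?F"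
      using z by (intro closed(3,6) EF \<open>\<i> \<in> ?F\<close>) auto
    then show "z \<in> ?F" by (simp flip: complex_eq)
  qed
qed

section \<open>SD maps on a subfield in characteristic 0\<close>

locale SD_map =
  fixes K :: "'a :: field_char_0 set" and f :: "'a \<Rightarrow> 'a"
  assumes subfield: "subfield K ring_of_type_algebra" and SD: "SD_map_on K f"
begin

lemmas zero = subfield_type_algebra_closed(1)[OF subfield]
  and one = subfield_type_algebra_closed(2)[OF subfield]
  and add = subfield_type_algebra_closed(3)[OF subfield]
  and minus = subfield_type_algebra_closed(4)[OF subfield]
  and diff = subfield_type_algebra_closed(5)[OF subfield]
  and mult = subfield_type_algebra_closed(6)[OF subfield]
  and divide = subfield_type_algebra_closed(7)[OF subfield]

lemma numeral: "numeral n \<in> K"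
  by (induction n) (simp_all only: numeral.simps one add)

lemma of_nat: "of_nat n \<in> K"
  by (induction n) (auto simp: zero one add)

lemma of_int: "of_int k \<in> K"
  by (cases k rule: int_cases2) (simp_all add: of_nat minus)

lemma Rats_subset: "\<rat> \<subseteq> K"
  by (auto elim!: Rats_cases' intro: divide of_int)

lemma f_inj: "x \<in> K \<Longrightarrow> y \<in> K \<Longrightarrow> x \<noteq> y \<Longrightarrow> f x \<noteq> f y"
  using SD unfolding SD_map_on_def by blast

lemma f_SD: "x \<in> K \<Longrightarrow> y \<in> K \<Longrightarrow> x \<noteq> y \<Longrightarrow> f ((x + y) / (x - y)) = (f x + f y) / (f x - f y)"
  using SD unfolding SD_map_on_def by blast

text \<open>With y = 0 the SD identity gives the same value \<open>f 1\<close> for every nonzero x.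
  Comparing x = 1 and x = 2, where \<open>f\<close> differs, forces \<open>f 1 = 1\<close>, and then
  \<open>f 0 = 0\<close>.\<close>

lemma f_1: "f 1 = 1" and f_0: "f 0 = 0"
proof -
  have *: "f x * (f 1 - 1) = f 0 * (f 1 + 1)" if "x \<in> K" "x \<noteq> 0" for x
  proof -
    have "f 1 = (f x + f 0) / (f x - f 0)"
      using f_SD[of x 0] that zero by simp
    moreover have "f x - f 0 \<noteq> 0" using f_inj[of x 0] that zero by simp
    ultimately have "f 1 * (f x - f 0) = f x + f 0" by simp
    then show ?thesis by (simp add: algebra_simps)
  qed
  have "(f 2 - f 1) * (f 1 - 1) = 0"
    using *[OF one] *[OF numeral[of "num.Bit0 num.One"]] by (simp add: algebra_simps)
  moreover have "f 2 - f 1 \<noteq> 0" using f_inj[of 2 1] one numeral by simp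
  ultimately show 1: "f 1 = 1" by simp
  then show "f 0 = 0" using *[OF one] by simp
qed

lemma f_neq_0: "x \<in> K \<Longrightarrow> x \<noteq> 0 \<Longrightarrow> f x \<noteq> 0"
  using f_inj[of x 0] zero f_0 by simp

text \<open>The pairs (c x, c) and (x, 1) have the same SD quotient. Clearing denominators in its
  two images leaves twice the claim.\<close>

lemma f_mult:
  assumes c: "c \<in> K" and x: "x \<in> K"
  shows "f (c * x) = f c * f x"
proof (cases "c = 0 \<or> x = 0 \<or> x = 1")
  case True
  then show ?thesis by (auto simp: f_0 f_1)
next
  case False
  have neq: "c * x \<noteq> c" using False by simp
  have "(f (c * x) + f c) / (f (c * x) - f c) = f ((c * x + c) / (c * x - c))"
    using f_SD[OF mult[OF c x] c neq] ..
  also have "(c * x + c) / (c * x - c) = (c * (x + 1)) / (c * (x - 1))"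
    by (simp add: algebra_simps)
  also have "\<dots> = (x + 1) / (x - 1)" using False by simp
  also have "f \<dots> = (f x + 1) / (f x - 1)"
    using f_SD[OF x one] False by (simp add: f_1)
  finally have "(f (c * x) + f c) / (f (c * x) - f c) = (f x + 1) / (f x - 1)" .
  moreover have "f (c * x) - f c \<noteq> 0" "f x - 1 \<noteq> 0"
    using f_inj[OF mult[OF c x] c neq] f_inj[OF x one] False by (auto simp: f_1)
  ultimately have "(f (c * x) + f c) * (f x - 1) = (f x + 1) * (f (c * x) - f c)"
    by (simp add: frac_eq_eq)
  then have "2 * f (c * x) = 2 * (f c * f x)" by (simp add: algebra_simps)
  then show ?thesis by simp
qed

lemma f_divide:
  assumes x: "x \<in> K" and y: "y \<in> K"
  shows "f (x / y) = f x / f y"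
proof (cases "y = 0")
  \<comment> \<open>Since x / 0 = 0, both sides are 0 here.\<close>
  case True
  then show ?thesis by (simp add: f_0)
next
  case False
  then have "f x = f (x / y) * f y" using f_mult[OF divide[OF x y] y] by simp
  then show ?thesis using f_neq_0[OF y False] by simp
qed

text \<open>The pair (x, - x) has SD quotient 0, which \<open>f\<close> maps to 0, so the numerator
  \<open>f x + f (- x)\<close> vanishes.\<close>

lemma f_minus:
  assumes x: "x \<in> K"
  shows "f (- x) = - f x"
proof (cases "x = 0")
  case False
  have "x \<noteq> - x" using False by (simp add: eq_neg_iff_add_eq_0 flip: mult_2)
  then have "(f x + f (- x)) / (f x - f (- x)) = 0" "f x - f (- x) \<noteq> 0"
    using f_SD[OF x minus[OF x]] f_inj[OF x minus[OF x]] by (auto simp: f_0)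
  then show ?thesis by (simp add: eq_neg_iff_add_eq_0 add.commute)
qed (simp add: f_0)

lemma f_2: "f 2 = 2"
proof -
  define a b where "a = f 2" and "b = f 3"
  note K = one numeral
  have a: "a - 1 \<noteq> 0" using f_inj[of 2 1] K by (simp add: a_def f_1)
  have ab: "b - a \<noteq> 0" using f_inj[of 3 2] K by (simp add: a_def b_def)
  have b: "b * (a - 1) = a + 1"
    using f_SD[of 2 1] K a by (simp add: a_def b_def f_1)
  have f4: "f 4 = a * a" using f_mult[of 2 2] K by (simp add: a_def)
  have 4: "a * a - 1 \<noteq> 0" using f_inj[of 4 1] K by (simp add: f4 f_1)
  have "f 5 = (b + a) / (b - a)"
    using f_SD[of 3 2] K by (simp add: a_def b_def)
  then have 5: "f 5 * (b - a) = b + a" using ab by simp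
  have "f (5 / 3) = (a * a + 1) / (a * a - 1)"
    using f_SD[of 4 1] K by (simp add: f4 f_1)
  then have "f 5 / b = (a * a + 1) / (a * a - 1)"
    using f_divide[of 5 3] K by (simp add: b_def)
  moreover have "b \<noteq> 0" using f_neq_0[of 3] K by (simp add: b_def)
  ultimately have 53: "f 5 * (a * a - 1) = (a * a + 1) * b"
    using 4 by (simp add: frac_eq_eq)
  have a1: "a + 1 \<noteq> 0"
    using 4 square_diff_one_factored[of a] by auto
  \<comment> \<open>\<open>e1\<close> is the route through 5 / 3: replacing
    \<open>b * (a - 1)\<close> by \<open>a + 1\<close> lets the common factor \<open>a + 1\<close>
    cancel. \<open>e2\<close> is the route through (3 + 2) / (3 - 2), with \<open>b\<close>
    eliminated in the same way.\<close>
  have "f 5 * ((a - 1) * (a - 1)) * (a + 1) = f 5 * (a * a - 1) * (a - 1)"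
    by (simp add: algebra_simps)
  also have "\<dots> = (a * a + 1) * (b * (a - 1))" by (simp only: 53 mult.assoc)
  finally have e1: "f 5 * ((a - 1) * (a - 1)) = a * a + 1" using a1 by (simp add: b)
  have "f 5 * (b * (a - 1) - a * (a - 1)) = (f 5 * (b - a)) * (a - 1)"
    by (simp add: algebra_simps)
  also have "\<dots> = b * (a - 1) + a * (a - 1)" unfolding 5 by (simp add: algebra_simps)
  finally have e2: "f 5 * (a + 1 - a * (a - 1)) = a * a + 1"
    unfolding b by (simp add: algebra_simps)
  \<comment> \<open>The right sides of \<open>e1\<close> and \<open>e2\<close> agree, so their left
    sides do; the difference factors and leaves only a = 2.\<close>
  have "2 * f 5 * a * (a - 2) = f 5 * ((a - 1) * (a - 1)) - f 5 * (a + 1 - a * (a - 1))"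
    by (simp add: algebra_simps)
  also have "\<dots> = 0" unfolding e1 e2 by simp
  finally have "2 * f 5 * a * (a - 2) = 0" .
  moreover have "f 5 \<noteq> 0" "a \<noteq> 0" using f_neq_0 K by (auto simp: a_def)
  ultimately show ?thesis by (simp add: a_def)
qed

text \<open>The pair (m + 1, 1) has quotient (m + 2) / m, so the values at m and m + 1 determine the
  one at m + 2. As m = 0 would divide by zero, n = 2 has to come from \<open>f_2\<close>.\<close>

lemma f_of_nat: "f (of_nat n) = of_nat n"
proof (induction n rule: less_induct)
  case (less n)
  consider "n = 0" | "n = 1" | "n = 2" | m where "n = Suc (Suc m)" "m \<ge> 1"
    by (metis One_nat_def Suc_1 less_one not_le old.nat.exhaust)
  then show ?case
  proof cases
    case 4
    let ?m = "of_nat m :: 'a"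
    have m: "?m \<noteq> 0" using 4 by simp
    have "f ((?m + 1 + 1) / (?m + 1 - 1)) = (f (?m + 1) + 1) / (f (?m + 1) - 1)"
      using f_SD[of "?m + 1" 1] of_nat one add m by (simp add: f_1)
    moreover have "f ?m = ?m" "f (?m + 1) = ?m + 1"
      using less.IH[of m] less.IH[of "Suc m"] 4 by (auto simp: add.commute)
    ultimately have "f (?m + 1 + 1) / ?m = (?m + 1 + 1) / ?m"
      using f_divide[OF add[OF add[OF of_nat[of m] one] one] of_nat[of m]] m
      by (simp only: add_diff_cancel_right')
    then have "f (?m + 1 + 1) = ?m + 1 + 1" using m by simp
    then show ?thesis using 4 by (simp add: add_ac)
  qed (simp_all add: f_0 f_1 f_2)
qed

lemma f_Rats:
  assumes "x \<in> \<rat>"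
  shows "f x = x"
proof -
  have f_int: "f (of_int k) = of_int k" for k
    by (cases k rule: int_cases2) (simp_all add: of_nat f_minus f_of_nat)
  obtain a b where "x = of_int a / of_int b"
    using assms by (cases x rule: Rats_cases') auto
  then show ?thesis by (simp add: f_divide of_int f_int)
qed

end

section \<open>Order, and the values of f on E\<close>

lemma strict_mono_on_fixing_Rats:
  fixes g :: "real \<Rightarrow> real"
  assumes "strict_mono_on S g" "\<rat> \<subseteq> S" "\<And>q. q \<in> \<rat> \<Longrightarrow> g q = q" "x \<in> S"
  shows "g x = x"
proof (rule ccontr)
  assume "g x \<noteq> x"
  \<comment> \<open>In either case a rational strictly between \<open>g x\<close> and
    \<open>x\<close> is fixed by \<open>g\<close>, against monotonicity.\<close>
  then consider "g x < x" | "x < g x" by linarith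
  then show False
  proof cases
    case 1
    then obtain q where "q \<in> \<rat>" "g x < q" "q < x" using Rats_dense_in_real by blast
    then show False using assms(2-4) strict_mono_onD[OF assms(1), of q x] by (metis less_asym subsetD)
  next
    case 2
    then obtain q where "q \<in> \<rat>" "x < q" "q < g x" using Rats_dense_in_real by blast
    then show False using assms(2-4) strict_mono_onD[OF assms(1), of x q] by (metis less_asym subsetD)
  qed
qed

theorem theorem4p6:
  fixes E :: "real set" and F :: "complex set" and f :: "complex \<Rightarrow> complex"
  assumes "euclidean_subfield E"
    and "F = quadratic_closure (complex_of_real ` E)"
    and "SD_map_on F f"
    and "f ` (F \<inter> \<real>) \<subseteq> \<real>"
  shows "(\<forall>z\<in>F. f z = z) \<or> (\<forall>z\<in>F. f z = cnj z)"
proof -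
  interpret SD_map F f
    using assms(3) subfield_quadratic_closure unfolding assms(2) by (rule SD_map.intro[rotated])
  have F: "z \<in> F \<longleftrightarrow> Re z \<in> E \<and> Im z \<in> E" for z
    using assms(2) quadratic_closure_euclidean[OF assms(1)] by simp
  have zeroE: "0 \<in> E" and oneE: "1 \<in> E" using zero one F by simp_all
  have EF: "complex_of_real x \<in> F" if "x \<in> E" for x using that zeroE by (simp add: F)
  \<comment> \<open>A real-valued copy of \<open>f\<close> on \<open>E\<close>, so that the order is
    available; by \<open>fg\<close>, taking the real part loses nothing there.\<close>
  define g where "g x = Re (f (of_real x))" for x
  have fg: "f (of_real x) = of_real (g x)" if "x \<in> E" for x
    using assms(4) EF[OF that] by (auto simp: g_def image_subset_iff)
  have g_neq_0: "g x \<noteq> 0" if "x \<in> E" "x \<noteq> 0" for x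
    using f_neq_0[OF EF[OF that(1)]] fg that by force
  have addE: "x + y \<in> E" and diffE: "x - y \<in> E" and divE: "x / y \<in> E"
    if "x \<in> E" "y \<in> E" for x y
    using add[OF EF EF] diff[OF EF EF] divide[OF EF EF] that
    by (simp_all add: F flip: of_real_divide)
  have g_pos: "g x > 0" if x: "x \<in> E" "x > 0" for x
  proof -
    have s: "sqrt x \<in> E" using euclidean_subfield_sqrt[OF assms(1)] x by simp
    have "complex_of_real x = of_real (sqrt x) * of_real (sqrt x)"
      using x by (simp flip: of_real_mult)
    then have "complex_of_real (g x) = of_real (g (sqrt x)) * of_real (g (sqrt x))"
      using f_mult[OF EF[OF s] EF[OF s]] fg[OF s] fg[OF x(1)] by metis
    then have "g x = g (sqrt x) * g (sqrt x)" by (simp flip: of_real_mult)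
    then show ?thesis
      using g_neq_0[OF x(1)] x(2) by (metis less_irrefl mult_zero_left not_real_square_gt_zero)
  qed
  have g_minus: "g (- x) = - g x" if "x \<in> E" for x
    using f_minus[OF EF[OF that]] by (simp add: g_def)
  \<comment> \<open>The SD quotient of x and y is positive, hence so is its image; the numerator
    \<open>g x + g y\<close> is positive, so the denominator is too.\<close>
  have g_less: "g y < g x" if "x \<in> E" "y \<in> E" "0 < y" "y < x" for x y
  proof -
    have q: "(x + y) / (x - y) \<in> E" "(x + y) / (x - y) > 0"
      using that addE diffE divE by auto
    have "complex_of_real (g ((x + y) / (x - y))) = of_real ((g x + g y) / (g x - g y))"
      using f_SD[OF EF EF, of x y] that fg q(1) fg[OF q(1)] by simp
    then have "0 < (g x + g y) / (g x - g y)"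
      using g_pos[OF q] by (simp only: of_real_eq_iff)
    then show ?thesis
      using g_pos[of x] g_pos[of y] that by (simp add: zero_less_divide_iff)
  qed
  have "strict_mono_on E g"
  proof (rule strict_mono_onI)
    fix x y assume xy: "x \<in> E" "y \<in> E" "x < y"
    have m: "- x \<in> E" "- y \<in> E" using diffE[OF zeroE] xy by fastforce+
    have g0: "g 0 = 0" by (simp add: g_def f_0)
    \<comment> \<open>\<open>g_less\<close> covers positive arguments only; oddness of
      \<open>g\<close> carries it to the negative ones.\<close>
    consider "0 < x" | "x = 0" | "x < 0" "0 < y" | "y = 0" | "y < 0" using xy by linarith
    then show "g x < g y"
    proof cases
      case 1
      then show ?thesis using g_less xy by simp
    next
      case 2
      then show ?thesis using g_pos xy g0 by simp
    next
      case 3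
      then show ?thesis using g_pos[of y] g_pos[of "- x"] g_minus xy m by simp
    next
      case 4
      then show ?thesis using g_pos[of "- x"] g_minus xy m g0 by simp
    next
      case 5
      then show ?thesis using g_less[of "- x" "- y"] g_minus xy m by simp
    qed
  qed
  moreover have rat: "complex_of_real q \<in> \<rat>" if "q \<in> \<rat>" for q
    using that by (cases q rule: Rats_cases') auto
  then have "\<rat> \<subseteq> E"
    using Rats_subset by (force simp: F)
  moreover have "g q = q" if "q \<in> \<rat>" for q
    using f_Rats[OF rat[OF that]] by (simp add: g_def)
  ultimately have "g x = x" if "x \<in> E" for x
    using strict_mono_on_fixing_Rats that by blast
  then have f_real: "f (of_real x) = of_real x" if "x \<in> E" for x
    using fg that by simp

  \<comment> \<open>Values at non-real points\<close>
  have iF: "\<i> \<in> F" by (simp add: F zeroE oneE)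
  have "f \<i> * f \<i> = - 1"
    using f_mult[OF iF iF] f_minus[OF one] by (simp add: f_1)
  then have fi: "f \<i> = \<i> \<or> f \<i> = - \<i>"
    by (metis power2_eq_square power2_eq_iff power2_i)
  \<comment> \<open>The expected value of \<open>f\<close>: the identity or \<open>cnj\<close>,
    according to the sign in \<open>f \<i>\<close>. The argument below gives \<open>f w\<close> only
    up to sign, hence the squares in \<open>f_sq\<close>.\<close>
  define h where "h z = of_real (Re z) + f \<i> * of_real (Im z)" for z
  have f_sq: "(f w)\<^sup>2 = (h w)\<^sup>2" if w: "w \<in> F" for w
  proof (cases "Im w = 0")
    case True
    then have "w = of_real (Re w)" by (simp add: complex_eq_iff)
    then have "f w = h w" using True f_real[of "Re w"] w by (simp add: h_def F)
    then show ?thesis by simp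
  next
    case False
    \<comment> \<open>With this splitting the SD quotient of x and y is \<open>w / cnj w\<close>,
      and \<open>x + f y\<close> is \<open>h w\<close>.\<close>
    define x y where "x = complex_of_real (Re w)" and "y = \<i> * complex_of_real (Im w)"
    have xF: "x \<in> F" and yF: "y \<in> F" and cF: "cnj w \<in> F"
      using w diffE[OF zeroE, of "Im w"] zeroE by (auto simp: x_def y_def F)
    have fx: "f x = x" and fy: "f y = f \<i> * of_real (Im w)"
      using w f_real f_mult[OF iF EF, of "Im w"] by (auto simp: x_def y_def F)
    have xy: "x \<noteq> y" using False by (auto simp: x_def y_def complex_eq_iff)
    have w_eq: "w = x + y" and c_eq: "cnj w = x - y"
      by (auto simp: x_def y_def complex_eq_iff)
    have "f w / f (cnj w) = (x + f y) / (x - f y)"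
      using f_SD[OF xF yF xy] f_divide[OF w cF] by (simp add: fx flip: w_eq c_eq)
    moreover have "x - f y \<noteq> 0" using f_inj[OF xF yF xy] by (simp add: fx)
    moreover have "f (cnj w) \<noteq> 0"
      using f_neq_0[OF cF] False by (metis complex_cnj_zero_iff zero_complex.sel(2))
    ultimately have quot: "f w * (x - f y) = (x + f y) * f (cnj w)"
      by (simp add: frac_eq_eq)
    \<comment> \<open>The norm is a real element of \<open>F\<close>, so \<open>f\<close> fixes it.
      As \<open>f y\<close> squares to \<open>- (Im w)\<^sup>2\<close>, it factors as
      \<open>(x + f y) * (x - f y)\<close>.\<close>
    have "w * cnj w \<in> F" using mult[OF w cF] .
    then have "f (w * cnj w) = w * cnj w"
      unfolding complex_mult_cnj by (intro f_real) (simp add: F)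
    then have "f w * f (cnj w) = of_real ((Re w)\<^sup>2 + (Im w)\<^sup>2)"
      using f_mult[OF w cF] by (simp only: complex_mult_cnj)
    moreover have "f y * f y = (f \<i> * f \<i>) * (of_real (Im w))\<^sup>2"
      by (simp only: fy power2_eq_square mult_ac)
    ultimately have prod: "f w * f (cnj w) = (x + f y) * (x - f y)"
      using \<open>f \<i> * f \<i> = - 1\<close> by (simp add: x_def algebra_simps power2_eq_square)
    \<comment> \<open>Combining quotient and product eliminates \<open>f (cnj w)\<close>.\<close>
    have "(f w)\<^sup>2 * (x - f y) = f w * (f w * (x - f y))"
      by (simp add: power2_eq_square)
    also have "\<dots> = (x + f y) * (f w * f (cnj w))" by (simp add: quot)
    also have "\<dots> = (x + f y)\<^sup>2 * (x - f y)" by (simp add: prod power2_eq_square)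
    finally have "(f w)\<^sup>2 * (x - f y) = (x + f y)\<^sup>2 * (x - f y)" .
    then show ?thesis using \<open>x - f y \<noteq> 0\<close> by (simp add: h_def fy x_def)
  qed
  have sqrt: "\<exists>w\<in>F. w\<^sup>2 = z" if "z \<in> F" for z
    using quadratics_split_sqrt[OF subfield] quadratics_split_quadratic_closure that assms(2)
    by blast
  \<comment> \<open>Passing to a square root \<open>w\<close> of \<open>z\<close> removes the sign
    ambiguity; both possible \<open>h\<close> commute with squaring.\<close>
  have f_h: "\<exists>w. w\<^sup>2 = z \<and> f z = (h w)\<^sup>2" if "z \<in> F" for z
    using sqrt[OF that] f_mult f_sq by (metis power2_eq_square)
  show ?thesis
    using fi
  proof
    assume "f \<i> = \<i>"
    then have "h w = w" for w by (simp add: h_def complex_eq_iff)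
    then show ?thesis using f_h by metis
  next
    assume "f \<i> = - \<i>"
    then have "h w = cnj w" for w by (simp add: h_def complex_eq_iff)
    then show ?thesis using f_h by (metis complex_cnj_power)
  qed
qed

end
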